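(* For all integers $n\geq 0$ we have $$H_n\big((2k+1)E_{2k}\big)=2^{2n(n+1)}\prod_{\ell=1}^n\ell!^4.$$
   Context: The Euler numbers $E_k$ are defined by $\frac{2}{e^t+e^{-t}}=\sum_{k\ge 0}E_k\frac{t^k}{k!}$. For a sequence $(c_0,c_1,\ldots)$ (indexed from $k=0$), $H_n(c_k)=\det\big(c_{i+j}\big)_{0\le i,j\le n}$; here $c_k=(2k+1)E_{2k}$. $\ell!^4=(\ell!)^4$, and empty products equal $1$. *)

theory Defs
  imports "HOL-Computational_Algebra.Formal_Power_Series" "Jordan_Normal_Form.Determinant"
begin

text \<open>The Euler numbers are the coefficients of the exponential generating function
  \<open>2 / (exp t + exp (-t))\<close>. The denominator has constant coefficient \<open>2\<close>, so it is a unit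
  and the formal quotient is an honest one.\<close>

definition euler_number :: "nat \<Rightarrow> real" where
  "euler_number k = fact k * fps_nth (2 / (fps_exp 1 + fps_exp (- 1))) k"

lemma euler_number_egf:
  "Abs_fps (\<lambda>k. euler_number k / fact k) = 2 / (fps_exp 1 + fps_exp (- 1))"
  by (simp add: fps_eq_iff euler_number_def)

lemma euler_number_egf_mult:
  "Abs_fps (\<lambda>k. euler_number k / fact k) * (fps_exp 1 + fps_exp (- 1)) = 2"
  unfolding euler_number_egf
  by (simp add: fps_divide_unit mult.assoc inverse_mult_eq_1)

text \<open>The index \<open>n\<close> is the largest row index, so the
  matrix has size \<open>n + 1\<close>.\<close>

definition hankel_det :: "nat \<Rightarrow> (nat \<Rightarrow> 'a :: comm_ring_1) \<Rightarrow> 'a" where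
  "hankel_det n c = det (mat (n + 1) (n + 1) (\<lambda>(i, j). c (i + j)))"

end

theory Submission imports Defs begin

text \<open>
  With \<open>F = (t sech t)'\<close> the entries are \<open>(2k+1) E\<^bsub>2k\<^esub> = (D\<^bsup>2k\<^esup> F)(0)\<close>, i.e. the moments
  in \<open>x = z\<^sup>2\<close> of the functional \<open>q \<mapsto> (q(D) F)(0)\<close>.
  Multiplying \<open>F\<close> by \<open>(exp t + exp (-t))\<^sup>2\<close> gives an elementary function, so the functional
  is known on \<open>q(z+2) + 2 q(z) + q(z-2)\<close>; from this its value on
  \<open>\<Prod>j=1..m. ((2j-1)\<^sup>2 - z\<^sup>2)\<close> is \<open>4^m m!\<^sup>2\<close>. The continuous dual Hahn polynomials with parameters
  \<open>1/2, 1/2, 1/2\<close> have binomial-type coefficients in this basis, so the functional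
  annihilates all but the first, and their three-term recurrence has
  \<open>\<beta>\<^sub>l = 16 l\<^sup>4\<close>. The Stieltjes matrix of the recurrence then
  yields an LU factorization of the Hankel matrix.
\<close>

section \<open>Stieltjes matrices and Hankel determinants\<close>

text \<open>Total weight of the Motzkin paths of length \<open>k\<close> from height 0 to height
  \<open>n\<close>, with weight 1 on rises, \<open>\<alpha> n\<close> on level steps at height
  \<open>n\<close> and \<open>\<beta> n\<close> on falls from height \<open>n\<close>.\<close>

fun stieltjes :: "(nat \<Rightarrow> 'a) \<Rightarrow> (nat \<Rightarrow> 'a) \<Rightarrow> nat \<Rightarrow> nat \<Rightarrow> 'a :: comm_ring_1" where
  "stieltjes \<alpha> \<beta> 0 n = (if n = 0 then 1 else 0)"
| "stieltjes \<alpha> \<beta> (Suc k) n = (case n of 0 \<Rightarrow> 0 | Suc m \<Rightarrow> stieltjes \<alpha> \<beta> k m)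
     + \<alpha> n * stieltjes \<alpha> \<beta> k n + \<beta> (Suc n) * stieltjes \<alpha> \<beta> k (Suc n)"

lemma stieltjes_eq_0: "k < n \<Longrightarrow> stieltjes \<alpha> \<beta> k n = 0"
  by (induction k arbitrary: n) (auto split: nat.splits)

lemma stieltjes_diag: "stieltjes \<alpha> \<beta> k k = 1"
  by (induction k) (auto simp: stieltjes_eq_0)

text \<open>The tridiagonal operator taking each row to the next is symmetric for the weights
  \<open>h\<close>, so truncating the sums at \<open>N\<close> leaves only a boundary term.\<close>

lemma stieltjes_telescope:
  fixes \<alpha> \<beta> :: "nat \<Rightarrow> 'a :: comm_ring_1"
  defines "a \<equiv> stieltjes \<alpha> \<beta>" and "h \<equiv> \<lambda>n. \<Prod>l=1..n. \<beta> l"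
  shows "(\<Sum>n\<le>N. h n * a (Suc i) n * a j n) - (\<Sum>n\<le>N. h n * a i n * a (Suc j) n)
    = h (Suc N) * (a i (Suc N) * a j N - a i N * a j (Suc N))"
proof (induction N)
  case 0
  show ?case by (simp add: a_def h_def algebra_simps)
next
  case (Suc N)
  have h: "h (Suc n) = \<beta> (Suc n) * h n" for n
    by (simp add: h_def)
  have a: "a (Suc k) (Suc N) = a k N + \<alpha> (Suc N) * a k (Suc N) + \<beta> (Suc (Suc N)) * a k (Suc (Suc N))" for k
    by (simp add: a_def)
  have "(\<Sum>n\<le>Suc N. h n * a (Suc i) n * a j n) - (\<Sum>n\<le>Suc N. h n * a i n * a (Suc j) n)
     = ((\<Sum>n\<le>N. h n * a (Suc i) n * a j n) - (\<Sum>n\<le>N. h n * a i n * a (Suc j) n))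
       + (h (Suc N) * a (Suc i) (Suc N) * a j (Suc N) - h (Suc N) * a i (Suc N) * a (Suc j) (Suc N))"
    by simp
  also have "\<dots> = h (Suc (Suc N)) * (a i (Suc (Suc N)) * a j (Suc N) - a i (Suc N) * a j (Suc (Suc N)))"
    unfolding Suc.IH a h[of "Suc N"] by (simp add: algebra_simps)
  finally show ?case .
qed

text \<open>Symmetry moves steps from \<open>i\<close> to \<open>j\<close> one at a time; the
  boundary terms vanish because both row indices stay below \<open>N + 1\<close>. The process ends
  at row 0, a unit vector.\<close>

lemma stieltjes_factorization:
  assumes "i + j \<le> N"
  shows "(\<Sum>n\<le>N. (\<Prod>l=1..n. \<beta> l) * stieltjes \<alpha> \<beta> i n * stieltjes \<alpha> \<beta> j n)
    = stieltjes \<alpha> \<beta> (i + j) 0"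
  using assms
proof (induction i arbitrary: j)
  case 0
  have "(\<Sum>n\<le>N. (\<Prod>l=1..n. \<beta> l) * stieltjes \<alpha> \<beta> 0 n * stieltjes \<alpha> \<beta> j n)
    = (\<Sum>n\<in>{0}. (\<Prod>l=1..n. \<beta> l) * stieltjes \<alpha> \<beta> 0 n * stieltjes \<alpha> \<beta> j n)"
    by (rule sum.mono_neutral_right) auto
  then show ?case by simp
next
  case (Suc i)
  have "stieltjes \<alpha> \<beta> i (Suc N) = 0" "stieltjes \<alpha> \<beta> j (Suc N) = 0"
    using Suc.prems by (auto intro: stieltjes_eq_0)
  with stieltjes_telescope[of \<beta> \<alpha> i j N]
  have "(\<Sum>n\<le>N. (\<Prod>l=1..n. \<beta> l) * stieltjes \<alpha> \<beta> (Suc i) n * stieltjes \<alpha> \<beta> j n)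
    = (\<Sum>n\<le>N. (\<Prod>l=1..n. \<beta> l) * stieltjes \<alpha> \<beta> i n * stieltjes \<alpha> \<beta> (Suc j) n)"
    by (simp del: stieltjes.simps)
  also have "\<dots> = stieltjes \<alpha> \<beta> (i + Suc j) 0"
    using Suc.prems by (intro Suc.IH) simp
  finally show ?case by (simp del: stieltjes.simps)
qed

text \<open>The Hankel matrix splits into a unit lower triangular \<open>A\<close> and
  \<open>B\<close>, the transpose of \<open>A\<close> with row \<open>m\<close> scaled by
  \<open>h m\<close>.\<close>

lemma hankel_det_stieltjes:
  fixes \<alpha> \<beta> :: "nat \<Rightarrow> 'a :: idom"
  shows "hankel_det n (\<lambda>k. stieltjes \<alpha> \<beta> k 0) = (\<Prod>m\<le>n. \<Prod>l=1..m. \<beta> l)"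
proof -
  define a where "a = stieltjes \<alpha> \<beta>"
  define h where "h = (\<lambda>m. \<Prod>l=1..m. \<beta> l)"
  define A where "A = mat (n + 1) (n + 1) (\<lambda>(i, m). a i m)"
  define B where "B = mat (n + 1) (n + 1) (\<lambda>(m, j). h m * a j m)"
  have A: "A \<in> carrier_mat (n + 1) (n + 1)" and B: "B \<in> carrier_mat (n + 1) (n + 1)"
    by (simp_all add: A_def B_def)
  have "mat (n + 1) (n + 1) (\<lambda>(i, j). a (i + j) 0) = A * B"
  proof (rule eq_matI)
    fix i j assume "i < dim_row (A * B)" "j < dim_col (A * B)"
    then have ij: "i < n + 1" "j < n + 1" by (simp_all add: A_def B_def)
    \<comment> \<open>The range up to \<open>2 * n\<close> is large enough for every
      \<open>i + j\<close>; terms past \<open>n\<close> then drop out by triangularity.\<close>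
    have "a (i + j) 0 = (\<Sum>m\<le>2 * n. h m * a i m * a j m)"
      unfolding a_def h_def using ij by (intro stieltjes_factorization[symmetric]) simp
    also have "\<dots> = (\<Sum>m<n + 1. h m * a i m * a j m)"
      using ij by (intro sum.mono_neutral_right) (auto simp: a_def stieltjes_eq_0)
    also have "\<dots> = (A * B) $$ (i, j)"
      using ij by (simp add: A_def B_def scalar_prod_def atLeast0LessThan mult_ac)
    finally show "mat (n + 1) (n + 1) (\<lambda>(i, j). a (i + j) 0) $$ (i, j) = (A * B) $$ (i, j)"
      using ij by simp
  qed (simp_all add: A_def B_def)
  then have "hankel_det n (\<lambda>k. a k 0) = det A * det B"
    unfolding hankel_det_def using det_mult[OF A B] by simp
  also have "det A = prod_list (diag_mat A)"
    by (rule det_lower_triangular[OF _ A]) (auto simp: A_def a_def stieltjes_eq_0)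
  also have "\<dots> = 1"
    by (simp add: A_def a_def diag_mat_def stieltjes_diag prod.list_conv_set_nth del: upt_Suc)
  also have "det B = prod_list (diag_mat B)"
    by (rule det_upper_triangular[OF _ B]) (auto simp: B_def a_def stieltjes_eq_0 upper_triangular_def)
  also have "\<dots> = (\<Prod>m\<le>n. h m)"
    by (simp add: B_def a_def diag_mat_def stieltjes_diag prod.list_conv_set_nth
        atLeast0LessThan lessThan_Suc_atMost del: upt_Suc)
  finally show ?thesis by (simp add: a_def h_def)
qed

text \<open>Multiplying the expansion by \<open>x\<close> and collecting terms reproduces the
  recursion of \<open>stieltjes\<close>. The condition \<open>\<beta> 0 = 0\<close> neutralizes the
  truncated index \<open>n - 1\<close> at \<open>n = 0\<close>.\<close>

lemma power_eq_sum_stieltjes: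
  fixes P :: "nat \<Rightarrow> 'a :: comm_ring_1 poly"
  assumes P0: "P 0 = 1" and "\<beta> 0 = 0"
    and rec: "\<And>n. x * P n = P (Suc n) + smult (\<alpha> n) (P n) + smult (\<beta> n) (P (n - 1))"
  shows "x ^ k = (\<Sum>n\<le>k. smult (stieltjes \<alpha> \<beta> k n) (P n))"
proof (induction k)
  case 0
  show ?case using P0 by simp
next
  case (Suc k)
  let ?a = "stieltjes \<alpha> \<beta> k"
  have "x ^ Suc k = (\<Sum>n\<le>k. smult (?a n) (x * P n))"
    by (simp add: Suc.IH sum_distrib_left)
  also have "\<dots> = (\<Sum>n\<le>k. smult (?a n) (P (Suc n))) + (\<Sum>n\<le>k. smult (\<alpha> n * ?a n) (P n))
      + (\<Sum>n\<le>k. smult (\<beta> n * ?a n) (P (n - 1)))"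
    by (simp add: rec smult_add_right sum.distrib mult.commute)
  also have "(\<Sum>n\<le>k. smult (?a n) (P (Suc n)))
      = (\<Sum>n\<le>Suc k. smult (case n of 0 \<Rightarrow> 0 | Suc m \<Rightarrow> ?a m) (P n))"
    by (simp only: sum.atMost_Suc_shift) simp
  also have "(\<Sum>n\<le>k. smult (\<alpha> n * ?a n) (P n)) = (\<Sum>n\<le>Suc k. smult (\<alpha> n * ?a n) (P n))"
    by (simp add: stieltjes_eq_0)
  also have "(\<Sum>n\<le>k. smult (\<beta> n * ?a n) (P (n - 1)))
      = (\<Sum>n\<le>Suc (Suc k). smult (\<beta> n * ?a n) (P (n - 1)))"
    by (simp add: stieltjes_eq_0)
  also have "\<dots> = (\<Sum>n\<le>Suc k. smult (\<beta> (Suc n) * ?a (Suc n)) (P n))"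
    by (simp only: sum.atMost_Suc_shift[of _ "Suc k"]) (simp add: \<open>\<beta> 0 = 0\<close>)
  finally show ?case
    by (simp only: stieltjes.simps smult_add_left sum.distrib)
qed

section \<open>Polynomials in the derivative acting on a power series\<close>

text \<open>The constant coefficient of \<open>q(D) f\<close>.\<close>

definition pairing :: "'a fps \<Rightarrow> 'a poly \<Rightarrow> 'a :: field_char_0" where
  "pairing f q = (\<Sum>i\<le>degree q. coeff q i * (fact i * fps_nth f i))"

lemma pairing_eq_sum:
  assumes "degree q \<le> N"
  shows "pairing f q = (\<Sum>i\<le>N. coeff q i * (fact i * fps_nth f i))"
  unfolding pairing_def using assms
  by (intro sum.mono_neutral_left) (auto simp: coeff_eq_0)

lemma pairing_0 [simp]: "pairing f 0 = 0"
  by (simp add: pairing_def)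

lemma pairing_add: "pairing f (p + q) = pairing f p + pairing f q"
proof -
  let ?N = "max (degree p) (degree q)"
  have "degree (p + q) \<le> ?N" by (rule degree_add_le_max)
  then show ?thesis
    by (simp add: pairing_eq_sum[of _ ?N] algebra_simps sum.distrib)
qed

lemma pairing_smult: "pairing f (smult c q) = c * pairing f q"
  by (simp add: pairing_eq_sum[of _ "degree q"] degree_smult_le sum_distrib_left mult.assoc)

lemma pairing_sum: "pairing f (\<Sum>i\<in>A. g i) = (\<Sum>i\<in>A. pairing f (g i))"
  by (induction A rule: infinite_finite_induct) (auto simp: pairing_add)

lemma pairing_add_left: "pairing (f + g) q = pairing f q + pairing g q"
  by (simp add: pairing_def algebra_simps sum.distrib)

lemma pairing_const_left: "pairing (fps_const c * f) q = c * pairing f q"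
  by (simp add: pairing_def sum_distrib_left mult_ac)

text \<open>Drives the inductions on \<open>q\<close>: raising all powers of D by one is absorbed by
  differentiating \<open>f\<close>.\<close>

lemma pairing_pCons: "pairing f (pCons c q) = c * fps_nth f 0 + pairing (fps_deriv f) q"
proof -
  have "pairing f (pCons c q)
      = (\<Sum>i\<le>Suc (degree q). coeff (pCons c q) i * (fact i * fps_nth f i))"
    by (intro pairing_eq_sum degree_pCons_le)
  also have "\<dots> = c * fps_nth f 0 + pairing (fps_deriv f) q"
    by (simp only: sum.atMost_Suc_shift) (simp add: pairing_def mult_ac)
  finally show ?thesis .
qed

lemma pairing_monom: "pairing f (monom 1 k) = fact k * fps_nth f k"
  by (simp add: pairing_eq_sum[of _ k] degree_monom_le if_distrib[of "\<lambda>x. x * _"] cong: if_cong)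

text \<open>Exponential shift: q(D) (e^(at) f) = e^(at) q(D + a) f, read off at t = 0.\<close>

lemma pairing_exp_mult: "pairing (fps_exp a * f) q = pairing f (q \<circ>\<^sub>p [:a, 1:])"
proof (induction q arbitrary: f)
  case 0
  show ?case by simp
next
  case (pCons c q)
  have "fps_deriv (fps_exp a * f) = fps_exp a * (fps_const a * f + fps_deriv f)"
    by (simp add: algebra_simps)
  moreover have "pCons c q \<circ>\<^sub>p [:a, 1:] =
      smult a (q \<circ>\<^sub>p [:a, 1:]) + pCons c (q \<circ>\<^sub>p [:a, 1:])"
    by (simp add: pcompose_pCons)
  ultimately show ?case
    by (simp only: pairing_pCons pCons.IH pairing_add pairing_smult pairing_add_left
        pairing_const_left) simp
qed

text \<open>As operators, q(D) t = t q(D) + q'(D), and the term with the factor t vanishes at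
  0.\<close>

lemma pairing_X_mult: "pairing (fps_X * f) q = pairing f (pderiv q)"
proof (induction q arbitrary: f)
  case 0
  show ?case by simp
next
  case (pCons c q)
  have "fps_deriv (fps_X * f) = f + fps_X * fps_deriv f"
    by simp
  then show ?case
    by (simp only: pairing_pCons pCons.IH pairing_add_left pderiv_pCons pairing_add) simp
qed

lemma pairing_one: "pairing 1 q = poly q 0"
proof (cases q)
  case (pCons c p)
  have "pairing 0 p = 0" by (simp add: pairing_def)
  then show ?thesis by (simp add: pCons pairing_pCons)
qed

lemma pairing_exp: "pairing (fps_exp a) q = poly q a"
  using pairing_exp_mult[of a 1 q] by (simp add: pairing_one poly_pcompose)

section \<open>The moment functional\<close>

definition sech_fps :: "real fps" where
  "sech_fps = Abs_fps (\<lambda>k. euler_number k / fact k)"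

definition moment_fps :: "real fps" where
  "moment_fps = fps_deriv (fps_X * sech_fps)"

lemma fact_moment_fps: "fact k * fps_nth moment_fps k = real (k + 1) * euler_number k"
  by (auto simp: moment_fps_def sech_fps_def field_simps)

text \<open>With S = sech, C = 2 cosh and D = 2 sinh, differentiating S C = 2 gives S' C = - S D.
  One more factor C clears the remaining S in S + t S'.\<close>

lemma moment_fps_cosh_sq:
  "moment_fps * (fps_exp 2 + 2 + fps_exp (-2))
    = 2 * (fps_exp 1 + fps_exp (-1)) - 2 * fps_X * (fps_exp 1 - fps_exp (-1))"
proof -
  define C where "C = fps_exp (1::real) + fps_exp (-1)"
  define D where "D = fps_exp (1::real) - fps_exp (-1)"
  have SC: "sech_fps * C = 2"
    unfolding sech_fps_def C_def by (rule euler_number_egf_mult)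
  have "fps_deriv C = D"
    by (simp add: C_def D_def fps_const_neg[symmetric] del: fps_const_neg)
  moreover have "fps_deriv (sech_fps * C) = 0"
    unfolding SC by simp
  ultimately have S'C: "fps_deriv sech_fps * C = - (sech_fps * D)"
    by (simp add: eq_neg_iff_add_eq_0 add.commute)
  have e: "fps_exp 1 * fps_exp (-1 :: real) = 1"
    by (simp add: fps_exp_add_mult[symmetric])
  have e2: "fps_exp 2 = fps_exp 1 * fps_exp (1 :: real)" "fps_exp (-2) = fps_exp (-1) * fps_exp (-1 :: real)"
    by (simp_all add: fps_exp_add_mult[symmetric])
  have CC: "fps_exp 2 + 2 + fps_exp (-2) = C * C"
    using e by (simp add: e2 C_def algebra_simps)
  have "moment_fps * (C * C) = (sech_fps * C) * C + fps_X * (fps_deriv sech_fps * C) * C"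
    by (simp add: moment_fps_def algebra_simps)
  also have "\<dots> = (sech_fps * C) * C - fps_X * (sech_fps * C) * D"
    unfolding S'C by (simp add: algebra_simps)
  also have "\<dots> = 2 * C - 2 * fps_X * D"
    unfolding SC by (simp add: mult_ac)
  finally show ?thesis by (simp add: CC C_def D_def)
qed

text \<open>The functional applied to both sides of the preceding identity: on the left exponentials
  act as shifts, on the right as evaluations, and the factor t produces the derivative.\<close>

lemma pairing_moment_shift:
  "pairing moment_fps (q \<circ>\<^sub>p [:2, 1:] + smult 2 q + q \<circ>\<^sub>p [:-2, 1:])
    = 2 * (poly q 1 + poly q (-1)) - 2 * (poly (pderiv q) 1 - poly (pderiv q) (-1))"
proof -
  have two: "(2 :: real fps) = fps_const 2"
    by (rule numeral_fps_const)
  have "pairing moment_fps (q \<circ>\<^sub>p [:2, 1:] + smult 2 q + q \<circ>\<^sub>p [:-2, 1:])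
    = pairing (fps_exp 2 * moment_fps + fps_const 2 * moment_fps + fps_exp (-2) * moment_fps) q"
    by (simp only: pairing_add pairing_add_left pairing_exp_mult pairing_smult pairing_const_left)
  also have "fps_exp 2 * moment_fps + fps_const 2 * moment_fps + fps_exp (-2) * moment_fps
    = moment_fps * (fps_exp 2 + 2 + fps_exp (-2))"
    by (simp add: two algebra_simps)
  also note moment_fps_cosh_sq
  also have "2 * (fps_exp (1 :: real) + fps_exp (-1)) - 2 * fps_X * (fps_exp 1 - fps_exp (-1))
    = fps_const 2 * fps_exp 1 + fps_const 2 * fps_exp (-1)
      + fps_const (-2) * (fps_X * fps_exp 1) + fps_const 2 * (fps_X * fps_exp (-1))"
    unfolding two
    by (simp add: algebra_simps fps_const_neg[symmetric] del: fps_const_neg)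
  finally show ?thesis
    by (simp add: pairing_add_left pairing_const_left pairing_exp pairing_X_mult del: fps_const_neg)
qed

section \<open>Values of the functional on products over odd squares\<close>

text \<open>Equals 4^m times the Pochhammer symbols ((1 - z)/2)_m and ((1 + z)/2)_m, the natural
  basis for these dual Hahn polynomials.\<close>

definition odd_basis :: "nat \<Rightarrow> real poly" where
  "odd_basis m = (\<Prod>j<m. [:(2 * real j + 1)\<^sup>2, 0, -1:])"

lemma odd_basis_Suc: "odd_basis (Suc m) = [:(2 * real m + 1)\<^sup>2, 0, -1:] * odd_basis m"
  by (simp add: odd_basis_def)

text \<open>The zeros are consecutive odd integers, so the shift keeps all zeros of
  \<open>odd_basis m\<close> and adds only -(2m+1) and -(2m+3).\<close>

lemma poly_odd_basis_shift:
  "poly (odd_basis (Suc m)) (z + 2) = - ((2 * real m + 3 + z) * (2 * real m + 1 + z)) * poly (odd_basis m) z"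
proof (induction m)
  case 0
  show ?case by (simp add: odd_basis_def power2_eq_square algebra_simps)
next
  case (Suc m)
  have "poly (odd_basis (Suc (Suc m))) (z + 2)
      = ((2 * real m + 1 - z) * (2 * real m + 5 + z)) * poly (odd_basis (Suc m)) (z + 2)"
    unfolding odd_basis_Suc[of "Suc m"] by (simp add: power2_eq_square algebra_simps)
  moreover have "poly (odd_basis (Suc m)) z
      = (2 * real m + 1 - z) * (2 * real m + 1 + z) * poly (odd_basis m) z"
    unfolding odd_basis_Suc by (simp add: power2_eq_square algebra_simps)
  ultimately show ?case
    unfolding Suc.IH by (simp add: mult_ac add_ac)
qed

lemma poly_odd_basis_minus: "poly (odd_basis m) (- z) = poly (odd_basis m) z"
  by (simp add: odd_basis_def poly_prod)

text \<open>Both shifts are multiples of \<open>odd_basis m\<close>, and their cofactors add up to a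
  linear polynomial in z^2, hence a combination of 1 and the last factor of
  \<open>odd_basis (Suc m)\<close>.\<close>

lemma odd_basis_shift_sum:
  "odd_basis (Suc m) \<circ>\<^sub>p [:2, 1:] + smult 2 (odd_basis (Suc m)) + odd_basis (Suc m) \<circ>\<^sub>p [:-2, 1:]
    = smult 4 (odd_basis (Suc m)) + smult (- 8 * (real m + 1) * (2 * real m + 1)) (odd_basis m)"
proof -
  have "poly (odd_basis (Suc m)) (z - 2) = poly (odd_basis (Suc m)) (- z + 2)" for z
    using poly_odd_basis_minus[of "Suc m" "z - 2"] by (simp add: algebra_simps)
  then have minus: "poly (odd_basis (Suc m)) (z - 2)
      = - ((2 * real m + 3 - z) * (2 * real m + 1 - z)) * poly (odd_basis m) z" for z
    by (simp only: poly_odd_basis_shift poly_odd_basis_minus) simp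
  have "poly (odd_basis (Suc m) \<circ>\<^sub>p [:2, 1:] + smult 2 (odd_basis (Suc m)) + odd_basis (Suc m) \<circ>\<^sub>p [:-2, 1:]) z
    = poly (smult 4 (odd_basis (Suc m)) + smult (- 8 * (real m + 1) * (2 * real m + 1)) (odd_basis m)) z" for z
  proof -
    have "poly (odd_basis (Suc m) \<circ>\<^sub>p [:2, 1:] + smult 2 (odd_basis (Suc m)) + odd_basis (Suc m) \<circ>\<^sub>p [:-2, 1:]) z
      = poly (odd_basis (Suc m)) (z + 2) + 2 * poly (odd_basis (Suc m)) z + poly (odd_basis (Suc m)) (z - 2)"
      by (simp add: poly_pcompose algebra_simps)
    also have "\<dots> = poly (smult 4 (odd_basis (Suc m)) + smult (- 8 * (real m + 1) * (2 * real m + 1)) (odd_basis m)) z"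
      unfolding poly_odd_basis_shift minus
      by (simp add: odd_basis_Suc power2_eq_square algebra_simps)
    finally show ?thesis .
  qed
  then show ?thesis by (simp add: poly_eq_poly_eq_iff[symmetric] fun_eq_iff)
qed

lemma poly_odd_basis_Suc_unit:
  "poly (odd_basis (Suc m)) 1 = 0" "poly (odd_basis (Suc m)) (-1) = 0"
proof (induction m)
  case (Suc m)
  show "poly (odd_basis (Suc (Suc m))) 1 = 0" "poly (odd_basis (Suc (Suc m))) (-1) = 0"
    unfolding odd_basis_Suc[of "Suc m"] poly_mult Suc.IH by simp_all
qed (simp_all add: odd_basis_def)

text \<open>Only the factor 1 - z^2 vanishes at 1 and -1; every other factor contributes (2j+1)^2 -
  1 = 4j(j+1).\<close>

lemma poly_pderiv_odd_basis_Suc_unit: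
  "poly (pderiv (odd_basis (Suc m))) 1 = - 2 * 4 ^ m * fact m * fact (Suc m)"
  "poly (pderiv (odd_basis (Suc m))) (-1) = 2 * 4 ^ m * fact m * fact (Suc m)"
proof (induction m)
  case 0
  show "poly (pderiv (odd_basis (Suc 0))) 1 = - 2 * 4 ^ 0 * fact 0 * fact (Suc 0)"
    "poly (pderiv (odd_basis (Suc 0))) (-1) = 2 * 4 ^ 0 * fact 0 * fact (Suc 0)"
    by (simp_all add: odd_basis_def pderiv_pCons)
next
  case (Suc m)
  have step: "poly (pderiv (odd_basis (Suc (Suc m)))) z
      = 4 * (real m + 1) * (real m + 2) * poly (pderiv (odd_basis (Suc m))) z"
    if "z\<^sup>2 = 1" "poly (odd_basis (Suc m)) z = 0" for z
  proof -
    have "poly (pderiv (odd_basis (Suc (Suc m)))) z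
        = ((2 * real (Suc m) + 1)\<^sup>2 - z\<^sup>2) * poly (pderiv (odd_basis (Suc m))) z"
      unfolding odd_basis_Suc[of "Suc m"] pderiv_mult poly_add poly_mult that(2)
      by (simp add: power2_eq_square)
    also have "(2 * real (Suc m) + 1)\<^sup>2 - z\<^sup>2 = 4 * (real m + 1) * (real m + 2)"
      unfolding that(1) by (simp add: power2_eq_square algebra_simps)
    finally show ?thesis .
  qed
  show "poly (pderiv (odd_basis (Suc (Suc m)))) 1 = - 2 * 4 ^ Suc m * fact (Suc m) * fact (Suc (Suc m))"
    "poly (pderiv (odd_basis (Suc (Suc m)))) (-1) = 2 * 4 ^ Suc m * fact (Suc m) * fact (Suc (Suc m))"
    by (simp_all only: step poly_odd_basis_Suc_unit Suc.IH power_one power2_minus simp_thms)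
      (simp_all add: algebra_simps)
qed

text \<open>The shift relation becomes a first-order recursion in \<open>m\<close>, whose solution
  multiplies by 4(m+1)^2 at each step.\<close>

lemma pairing_moment_odd_basis: "pairing moment_fps (odd_basis m) = 4 ^ m * (fact m)\<^sup>2"
proof (induction m)
  case 0
  have "euler_number 0 = 1"
    by (simp add: euler_number_def fps_divide_unit)
  then show ?case
    using fact_moment_fps[of 0] by (simp add: odd_basis_def pairing_def)
next
  case (Suc m)
  have "4 * pairing moment_fps (odd_basis (Suc m))
      - 8 * (real m + 1) * (2 * real m + 1) * (4 ^ m * (fact m)\<^sup>2)
      = 8 * 4 ^ m * fact m * fact (Suc m)"
    using pairing_moment_shift[of "odd_basis (Suc m)"]
    unfolding odd_basis_shift_sum poly_odd_basis_Suc_unit poly_pderiv_odd_basis_Suc_unit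
      pairing_add pairing_smult Suc.IH
    by (simp add: algebra_simps)
  then show ?case
    by (simp add: power2_eq_square algebra_simps)
qed

section \<open>The orthogonal polynomials\<close>

text \<open>The denominator is the functional's value on \<open>odd_basis m\<close>; the numerator
  factor makes \<open>dual_hahn n\<close> monic in z^2.\<close>

definition dual_hahn_coeff :: "nat \<Rightarrow> nat \<Rightarrow> real" where
  "dual_hahn_coeff n m = (-1) ^ m * 4 ^ n * (fact n)\<^sup>2 * real (n choose m) / (4 ^ m * (fact m)\<^sup>2)"

definition dual_hahn :: "nat \<Rightarrow> real poly" where
  "dual_hahn n = (\<Sum>m\<le>n. smult (dual_hahn_coeff n m) (odd_basis m))"

lemma dual_hahn_eq_sum:
  "n \<le> N \<Longrightarrow> dual_hahn n = (\<Sum>m\<le>N. smult (dual_hahn_coeff n m) (odd_basis m))"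
  unfolding dual_hahn_def by (intro sum.mono_neutral_left) (auto simp: dual_hahn_coeff_def)

lemma dual_hahn_coeff_rec_0:
  "dual_hahn_coeff n 0 = dual_hahn_coeff (Suc n) 0
    - (8 * real n ^ 2 + 8 * real n + 3) * dual_hahn_coeff n 0
    + 16 * real n ^ 4 * dual_hahn_coeff (n - 1) 0"
  by (cases n) (simp_all add: dual_hahn_coeff_def power2_eq_square power4_eq_xxxx algebra_simps)

text \<open>This compares coefficients of \<open>odd_basis (Suc k)\<close> in the three-term
  recurrence. All terms share the factor \<open>W\<close>, which leaves an identity between
  neighbouring binomials.\<close>

lemma dual_hahn_coeff_rec_Suc:
  "(2 * real (Suc k) + 1)\<^sup>2 * dual_hahn_coeff n (Suc k) - dual_hahn_coeff n k
    = dual_hahn_coeff (Suc n) (Suc k)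
    - (8 * real n ^ 2 + 8 * real n + 3) * dual_hahn_coeff n (Suc k)
    + 16 * real n ^ 4 * dual_hahn_coeff (n - 1) (Suc k)"
proof -
  define W where "W = (-1) ^ Suc k * 4 ^ n * (fact n)\<^sup>2 / (4 ^ Suc k * (fact (Suc k))\<^sup>2 :: real)"
  define c where "c = real (n choose k)"
  define d where "d = real (n choose Suc k)"
  define e where "e = real ((n - 1) choose Suc k)"
  have cd: "(real k + 1) * d = (real n - real k) * c"
  proof (cases "k \<le> n")
    case True
    have "Suc k * (n choose Suc k) = (n - k) * (n choose k)"
      by (metis binomial_absorb_comp binomial_absorption mult.commute)
    then have "real (Suc k) * d = real (n - k) * c"
      unfolding c_def d_def by (metis of_nat_mult)
    then show ?thesis using True by (simp add: of_nat_diff add.commute)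
  qed (simp add: c_def d_def binomial_eq_0)
  have de: "real n * e = (real n - real k - 1) * d"
  proof (cases "Suc k \<le> n")
    case True
    have "(n - Suc k) * (n choose Suc k) = n * ((n - 1) choose Suc k)"
      by (rule binomial_absorb_comp)
    then have "real (n - Suc k) * d = real n * e"
      unfolding e_def d_def by (metis of_nat_mult)
    then show ?thesis using True by (simp add: of_nat_diff algebra_simps)
  qed (simp add: e_def d_def binomial_eq_0)
  have w1: "dual_hahn_coeff n (Suc k) = W * d"
    by (simp add: dual_hahn_coeff_def W_def d_def)
  have w2: "dual_hahn_coeff n k = - 4 * (real k + 1)\<^sup>2 * (W * c)"
  proof -
    define V where "V = (-1) ^ k * 4 ^ n * (fact n)\<^sup>2 / (4 ^ k * (fact k)\<^sup>2 :: real)"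
    have "W = - V / (4 * (real k + 1)\<^sup>2)"
      by (simp add: W_def V_def power_mult_distrib add.commute mult_ac)
    moreover have "real k + 1 \<noteq> 0" by simp
    ultimately have "V = - 4 * (real k + 1)\<^sup>2 * W" by simp
    moreover have "dual_hahn_coeff n k = V * c"
      by (simp add: dual_hahn_coeff_def V_def c_def)
    ultimately show ?thesis by simp
  qed
  have w3: "dual_hahn_coeff (Suc n) (Suc k) = 4 * (real n + 1)\<^sup>2 * (W * (c + d))"
  proof -
    have "(fact (Suc n))\<^sup>2 = (real n + 1)\<^sup>2 * (fact n)\<^sup>2"
      by (simp add: power_mult_distrib add.commute)
    then show ?thesis
      by (simp add: dual_hahn_coeff_def W_def c_def d_def mult_ac del: fact_Suc)
  qed
  have w4: "16 * real n ^ 4 * dual_hahn_coeff (n - 1) (Suc k) = 4 * real n * (W * (real n * e))"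
  proof (cases n)
    case (Suc p)
    then have "(fact n)\<^sup>2 = (real n)\<^sup>2 * (fact p)\<^sup>2" "4 ^ n = 4 * (4 :: real) ^ p" "n - 1 = p"
      by (simp_all add: power_mult_distrib)
    then show ?thesis
      by (simp add: dual_hahn_coeff_def W_def e_def power2_eq_square power4_eq_xxxx mult_ac
          del: fact_Suc)
  qed simp
  \<comment> \<open>After \<open>de\<close>, the identity to prove is \<open>cd\<close> times this
    multiplier: the coefficients of \<open>c\<close> differ by 4(n-k)(n+k+2), those of
    \<open>d\<close> by 4(k+1)(n+k+2).\<close>
  have "4 * (real n + real k + 2) * ((real k + 1) * d) = 4 * (real n + real k + 2) * ((real n - real k) * c)"
    by (simp only: cd)
  then have "(2 * real (Suc k) + 1)\<^sup>2 * d + 4 * (real k + 1)\<^sup>2 * c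
    = 4 * (real n + 1)\<^sup>2 * (c + d) - (8 * real n ^ 2 + 8 * real n + 3) * d
      + 4 * real n * ((real n - real k - 1) * d)"
    by (simp add: power2_eq_square algebra_simps)
  then have "W * ((2 * real (Suc k) + 1)\<^sup>2 * d + 4 * (real k + 1)\<^sup>2 * c)
    = W * (4 * (real n + 1)\<^sup>2 * (c + d) - (8 * real n ^ 2 + 8 * real n + 3) * d
      + 4 * real n * ((real n - real k - 1) * d))"
    by (rule arg_cong)
  then show ?thesis
    unfolding w1 w2 w3 w4 de by (simp add: algebra_simps)
qed

lemma X_sq_odd_basis:
  "monom 1 2 * odd_basis m = smult ((2 * real m + 1)\<^sup>2) (odd_basis m) - odd_basis (Suc m)"
proof -
  have "monom 1 2 = [:(2 * real m + 1)\<^sup>2:] - [:(2 * real m + 1)\<^sup>2, 0, -1:]"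
    by (simp add: monom_altdef numeral_2_eq_2)
  then show ?thesis by (simp add: odd_basis_Suc algebra_simps)
qed

lemma smult_sum_right: "smult c (\<Sum>i\<in>A. p i) = (\<Sum>i\<in>A. smult c (p i))"
  by (induction A rule: infinite_finite_induct) (simp_all add: smult_add_right)

lemma dual_hahn_rec:
  "monom 1 2 * dual_hahn n = dual_hahn (Suc n)
    + smult (- (8 * real n ^ 2 + 8 * real n + 3)) (dual_hahn n)
    + smult (16 * real n ^ 4) (dual_hahn (n - 1))"
proof -
  let ?w = dual_hahn_coeff
  have "?w n (Suc n) = 0"
    by (simp add: dual_hahn_coeff_def)
  then have "monom 1 2 * dual_hahn n
      = (\<Sum>m\<le>Suc n. smult ((2 * real m + 1)\<^sup>2 * ?w n m) (odd_basis m))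
        - (\<Sum>m\<le>n. smult (?w n m) (odd_basis (Suc m)))"
    by (simp add: dual_hahn_def sum_distrib_left X_sq_odd_basis smult_diff_right
        sum_subtractf mult.commute[of "_\<^sup>2"])
  \<comment> \<open>At index 0 the factor (2*0+1)^2 is 1, so that term is the left side of
    \<open>dual_hahn_coeff_rec_0\<close>.\<close>
  also have "\<dots> = smult (?w n 0) (odd_basis 0) + (\<Sum>m\<le>n. smult
      ((2 * real (Suc m) + 1)\<^sup>2 * ?w n (Suc m) - ?w n m) (odd_basis (Suc m)))"
    by (simp only: sum.atMost_Suc_shift smult_diff_left sum_subtractf) simp
  also have "\<dots> = (\<Sum>m\<le>Suc n. smult (?w (Suc n) m
      - (8 * real n ^ 2 + 8 * real n + 3) * ?w n m + 16 * real n ^ 4 * ?w (n - 1) m) (odd_basis m))"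
    by (simp only: sum.atMost_Suc_shift dual_hahn_coeff_rec_Suc flip: dual_hahn_coeff_rec_0)
  also have "\<dots> = dual_hahn (Suc n)
    + smult (- (8 * real n ^ 2 + 8 * real n + 3)) (dual_hahn n)
    + smult (16 * real n ^ 4) (dual_hahn (n - 1))"
    by (simp only: dual_hahn_eq_sum[of _ "Suc n"] le_refl le_SucI diff_le_self smult_sum_right
        smult_smult smult_add_left smult_diff_left sum.distrib sum_subtractf
        smult_minus_left mult_minus_left sum_negf diff_conv_add_uminus)
  finally show ?thesis .
qed

text \<open>The values on the basis cancel the denominators of the coefficients, leaving an
  alternating sum of binomials.\<close>

lemma pairing_moment_dual_hahn: "pairing moment_fps (dual_hahn n) = (if n = 0 then 1 else 0)"
proof -
  have "pairing moment_fps (dual_hahn n) = (\<Sum>m\<le>n. dual_hahn_coeff n m * (4 ^ m * (fact m)\<^sup>2))"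
    by (simp add: dual_hahn_def pairing_sum pairing_smult pairing_moment_odd_basis)
  also have "\<dots> = 4 ^ n * (fact n)\<^sup>2 * (\<Sum>m\<le>n. (-1) ^ m * real (n choose m))"
    by (simp add: sum_distrib_left dual_hahn_coeff_def mult_ac)
  also have "\<dots> = (if n = 0 then 1 else 0)"
    using choose_alternating_sum[of n, where ?'a = real] by (cases "n = 0") simp_all
  finally show ?thesis .
qed

text \<open>Expanding (z^2)^k in the dual Hahn polynomials and applying the functional keeps only
  the coefficient of the zeroth one.\<close>

lemma moment_eq_stieltjes:
  "real (2 * k + 1) * euler_number (2 * k)
    = stieltjes (\<lambda>n. - (8 * real n ^ 2 + 8 * real n + 3)) (\<lambda>n. 16 * real n ^ 4) k 0"
    (is "_ = stieltjes ?\<alpha> ?\<beta> k 0")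
proof -
  have P0: "dual_hahn 0 = 1"
    by (simp add: dual_hahn_def dual_hahn_coeff_def odd_basis_def)
  have "real (2 * k + 1) * euler_number (2 * k) = pairing moment_fps (monom 1 2 ^ k)"
    by (simp add: monom_power pairing_monom fact_moment_fps mult.commute)
  also have "monom 1 2 ^ k = (\<Sum>n\<le>k. smult (stieltjes ?\<alpha> ?\<beta> k n) (dual_hahn n))"
    by (rule power_eq_sum_stieltjes[where \<alpha> = ?\<alpha> and \<beta> = ?\<beta>, OF P0 _ dual_hahn_rec]) simp
  also have "pairing moment_fps \<dots> = stieltjes ?\<alpha> ?\<beta> k 0"
    by (simp add: pairing_sum pairing_smult pairing_moment_dual_hahn if_distrib cong: if_cong)
  finally show ?thesis .
qed

theorem corollary5p2:
  fixes n :: nat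
  shows "hankel_det n (\<lambda>k. real (2 * k + 1) * euler_number (2 * k)) =
    2 ^ (2 * n * (n + 1)) * (\<Prod>l = 1..n. fact l ^ 4)"
proof -
  have "(\<Prod>l=1..m. 16 * real l ^ 4) = 16 ^ m * fact m ^ 4" for m
    by (simp add: prod.distrib fact_prod prod_power_distrib)
  then have "hankel_det n (\<lambda>k. real (2 * k + 1) * euler_number (2 * k))
      = (\<Prod>m\<le>n. 16 ^ m * fact m ^ 4)"
    unfolding moment_eq_stieltjes hankel_det_stieltjes by simp
  also have "\<dots> = 2 ^ (2 * n * (n + 1)) * (\<Prod>l = 1..n. fact l ^ 4)"
  proof (induction n)
    case (Suc n)
    \<comment> \<open>The new factor 16^(n+1) accounts for the growth of the exponent: 2(n+1)(n+2) =
      2n(n+1) + 4(n+1).\<close>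
    have "2 ^ (2 * Suc n * (Suc n + 1)) = 2 ^ (2 * n * (n + 1)) * (2 ^ 4 :: real) ^ Suc n"
      unfolding power_mult[symmetric] power_add[symmetric] by (rule arg_cong) simp
    then show ?case by (simp add: Suc.IH)
  qed simp
  finally show ?thesis .
qed

end
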